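(* Let $\Gamma$ be a finite nonabelian group with $|Z(\Gamma)|\geq 2$, and let $\mathscr{C}$ be the collection of all maximal abelian subgroups of $\Gamma$. If $|\mathscr{C}|\leq 2^{|Z(\Gamma)|}$, then $rc(CG(\Gamma))=2$.
   Context: For a finite group $\Gamma$, the commuting graph $CG(\Gamma)$ is the simple graph with vertex set $\Gamma$ in which two distinct elements $a,b$ are adjacent if and only if $ab=ba$. For a connected graph $G$, an edge coloring (adjacent edges may share colors) makes $G$ rainbow-connected if every two distinct vertices are joined by a path whose edges all have pairwise distinct colors; the rainbow connection number $rc(G)$ is the minimum number of colors in such a coloring. $Z(\Gamma)=\{z\in\Gamma: za=az \text{ for all } a\in\Gamma\}$ is the center of $\Gamma$. A maximal abelian subgroup of $\Gamma$ is an abelian subgroup not properly contained in any other abelian subgroup of $\Gamma$. *)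

theory Defs
  imports "HOL-Algebra.Algebra"
begin

text \<open>A simple graph is a pair (vertex set, edge set); edges are two-element sets of vertices.\<close>

type_synonym 'a sgraph = "'a set \<times> 'a set set"

abbreviation verts :: "'a sgraph \<Rightarrow> 'a set" where
  "verts Q \<equiv> fst Q"

abbreviation edges :: "'a sgraph \<Rightarrow> 'a set set" where
  "edges Q \<equiv> snd Q"

text \<open>A walk is given by its list of vertices; for vertices \<open>[v\<^sub>0, \<dots>, v\<^sub>n]\<close> the edges
  traversed are \<open>[{v\<^sub>0, v\<^sub>1}, \<dots>, {v\<^sub>n\<^sub>-\<^sub>1, v\<^sub>n}]\<close>.\<close>

fun path_edges :: "'a list \<Rightarrow> 'a set list" where
  "path_edges (u # v # p) = {u, v} # path_edges (v # p)"
| "path_edges _ = []"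

definition path_between :: "'a sgraph \<Rightarrow> 'a \<Rightarrow> 'a list \<Rightarrow> 'a \<Rightarrow> bool" where
  "path_between Q u p v \<longleftrightarrow>
     p \<noteq> [] \<and> hd p = u \<and> last p = v \<and> distinct p \<and>
     set p \<subseteq> verts Q \<and> set (path_edges p) \<subseteq> edges Q"

definition rainbow_coloring :: "'a sgraph \<Rightarrow> ('a set \<Rightarrow> nat) \<Rightarrow> bool" where
  "rainbow_coloring Q c \<longleftrightarrow>
     (\<forall>u \<in> verts Q. \<forall>v \<in> verts Q. u \<noteq> v \<longrightarrow>
        (\<exists>p. path_between Q u p v \<and> distinct (map c (path_edges p))))"

text \<open>The least number of colors of a rainbow coloring, the colors being \<open>0, \<dots>, k - 1\<close>.
  It is meaningful for finite connected graphs only: for a disconnected graph there is no such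
  \<open>k\<close>, and the value of \<open>LEAST\<close> is unspecified.\<close>

definition rainbow_connection_number :: "'a sgraph \<Rightarrow> nat" where
  "rainbow_connection_number Q =
     (LEAST k. \<exists>c. c ` edges Q \<subseteq> {..<k} \<and> rainbow_coloring Q c)"

definition commuting_graph :: "('a, 'b) monoid_scheme \<Rightarrow> 'a sgraph" where
  "commuting_graph G =
     (carrier G,
      {{a, b} | a b. a \<in> carrier G \<and> b \<in> carrier G \<and> a \<noteq> b \<and> a \<otimes>\<^bsub>G\<^esub> b = b \<otimes>\<^bsub>G\<^esub> a})"

definition center :: "('a, 'b) monoid_scheme \<Rightarrow> 'a set" where
  "center G = {z \<in> carrier G. \<forall>a \<in> carrier G. z \<otimes>\<^bsub>G\<^esub> a = a \<otimes>\<^bsub>G\<^esub> z}"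

definition abelian_subgroup :: "'a set \<Rightarrow> ('a, 'b) monoid_scheme \<Rightarrow> bool" where
  "abelian_subgroup H G \<longleftrightarrow> subgroup H G \<and> comm_group (G\<lparr>carrier := H\<rparr>)"

definition maximal_abelian_subgroup :: "'a set \<Rightarrow> ('a, 'b) monoid_scheme \<Rightarrow> bool" where
  "maximal_abelian_subgroup H G \<longleftrightarrow>
     abelian_subgroup H G \<and> \<not> (\<exists>K. abelian_subgroup K G \<and> H \<subset> K)"

end

theory Submission
  imports Defs
begin

text \<open>Any two noncommuting elements are joined only by paths with at least two edges, so two
  colors are necessary. Conversely, the bound on the number of maximal abelian subgroups allows
  one to label them by distinct subsets of the center. Choose for every noncentral element a
  maximal abelian subgroup containing it, and color the edge from \<open>g\<close> to a central element \<open>z\<close> by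
  whether \<open>z\<close> belongs to the label of the subgroup chosen for \<open>g\<close>. Noncommuting \<open>u\<close> and \<open>v\<close> have
  different chosen subgroups, hence a central \<open>z\<close> lying in exactly one of the two labels, and
  \<open>u, z, v\<close> is a rainbow path.\<close>

lemma verts_commuting_graph [simp]: "verts (commuting_graph G) = carrier G"
  by (simp add: commuting_graph_def)

lemma edge_commuting_graph_iff:
  "{a, b} \<in> edges (commuting_graph G) \<longleftrightarrow>
     a \<in> carrier G \<and> b \<in> carrier G \<and> a \<noteq> b \<and> a \<otimes>\<^bsub>G\<^esub> b = b \<otimes>\<^bsub>G\<^esub> a"
  by (auto simp: commuting_graph_def doubleton_eq_iff)

lemma path_between_edge:
  assumes "{u, v} \<in> edges Q" "u \<in> verts Q" "v \<in> verts Q" "u \<noteq> v"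
  shows "path_between Q u [u, v] v"
  using assms by (simp add: path_between_def)

lemma length_path_edges: "length (path_edges p) = length p - 1"
  by (induction p rule: path_edges.induct) auto

text \<open>A rainbow path between distinct nonadjacent vertices has at least two edges, and these
  carry pairwise different colors from \<open>{..<k}\<close>.\<close>

lemma rainbow_coloring_nonadjacent_card:
  assumes "rainbow_coloring Q c" "c ` edges Q \<subseteq> {..<k}"
    and "u \<in> verts Q" "v \<in> verts Q" "u \<noteq> v" "{u, v} \<notin> edges Q"
  shows "2 \<le> k"
proof -
  obtain p where p: "path_between Q u p v" "distinct (map c (path_edges p))"
    using assms(1,3,4,5) unfolding rainbow_coloring_def by blast
  have "2 \<le> length (path_edges p)"
  proof (cases p rule: path_edges.cases)
    \<comment> \<open>If \<open>q\<close> were empty, \<open>p\<close> would be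
      \<open>[u, v]\<close> and \<open>{u, v}\<close> an edge.\<close>
    case (1 x y q)
    then show ?thesis
      using p(1) assms(5,6) by (cases q) (auto simp: path_between_def length_path_edges)
  qed (use p(1) assms(5) in \<open>auto simp: path_between_def\<close>)
  also have "\<dots> = card (c ` set (path_edges p))"
    using p(2) distinct_card by fastforce
  also have "\<dots> \<le> card {..<k}"
    using p(1) assms(2) by (intro card_mono) (auto simp: path_between_def)
  finally show ?thesis by simp
qed

context group
begin

lemma abelian_subgroup_commute:
  assumes "abelian_subgroup H G" "x \<in> H" "y \<in> H"
  shows "x \<otimes> y = y \<otimes> x"
proof -
  interpret H: comm_group "G\<lparr>carrier := H\<rparr>"
    using assms(1) by (simp add: abelian_subgroup_def)
  show ?thesis using H.m_comm assms(2,3) by simp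
qed

text \<open>Powers of \<open>g\<close> commute because their integer exponents add. This is the
  starting point for reaching a maximal abelian subgroup around \<open>g\<close>.\<close>

lemma abelian_subgroup_generate_singleton:
  assumes "g \<in> carrier G"
  shows "abelian_subgroup (generate G {g}) G"
proof -
  have sub: "subgroup (generate G {g}) G"
    using assms by (intro generate_is_subgroup) auto
  interpret H: group "G\<lparr>carrier := generate G {g}\<rparr>"
    using subgroup_imp_group[OF sub] .
  have "comm_group (G\<lparr>carrier := generate G {g}\<rparr>)"
    by (rule H.group_comm_groupI)
       (auto simp: generate_pow[OF assms] int_pow_mult[OF assms, symmetric] add.commute)
  with sub show ?thesis by (simp add: abelian_subgroup_def)
qed

lemma finite_abelian_subgroups:
  assumes "finite (carrier G)"
  shows "finite {H. abelian_subgroup H G}"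
  by (rule finite_subset[of _ "Pow (carrier G)"])
     (auto simp: assms abelian_subgroup_def dest: subgroup.mem_carrier)

text \<open>Only finitely many abelian subgroups exist, so some maximal one lies above the cyclic
  subgroup generated by \<open>g\<close>.\<close>

lemma ex_maximal_abelian_subgroup:
  assumes "finite (carrier G)" "g \<in> carrier G"
  obtains H where "maximal_abelian_subgroup H G" "g \<in> H"
proof -
  have gen: "generate G {g} \<in> {H. abelian_subgroup H G}"
    using abelian_subgroup_generate_singleton[OF assms(2)] by simp
  obtain H where H: "abelian_subgroup H G" "generate G {g} \<subseteq> H"
      "\<forall>K \<in> {H. abelian_subgroup H G}. H \<subseteq> K \<longrightarrow> H = K"
    using finite_has_maximal2[OF finite_abelian_subgroups[OF assms(1)] gen]
    by (elim bexE conjE CollectE) rule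
  have "maximal_abelian_subgroup H G"
    using H(1,3) unfolding maximal_abelian_subgroup_def by blast
  moreover have "g \<in> H"
    using H(2) by (auto intro: generate.incl)
  ultimately show ?thesis by (rule that)
qed

lemma finite_maximal_abelian_subgroups:
  assumes "finite (carrier G)"
  shows "finite {H. maximal_abelian_subgroup H G}"
  by (rule finite_subset[OF _ finite_abelian_subgroups[OF assms]])
     (auto simp: maximal_abelian_subgroup_def)

lemma ex_noncommuting:
  assumes "\<not> comm_group G"
  obtains u v where "u \<in> carrier G" "v \<in> carrier G" "u \<otimes> v \<noteq> v \<otimes> u"
  using assms group_comm_groupI by blast

lemma ex_rainbow_2_coloring_commuting_graph:
  assumes fin: "finite (carrier G)"
    and card: "card {H. maximal_abelian_subgroup H G} \<le> 2 ^ card (center G)"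
  obtains c where "c ` edges (commuting_graph G) \<subseteq> {..<2}"
    and "rainbow_coloring (commuting_graph G) c"
proof -
  let ?C = "{H. maximal_abelian_subgroup H G}" and ?Z = "center G"
  have ZG: "?Z \<subseteq> carrier G"
    by (auto simp: center_def)
  have Z_comm: "z \<otimes> a = a \<otimes> z" if "z \<in> ?Z" "a \<in> carrier G" for z a
    using that by (simp add: center_def)
  have finZ: "finite ?Z"
    using ZG fin by (rule finite_subset)
  \<comment> \<open>The labelling: \<open>Pow ?Z\<close> has \<open>2 ^ card ?Z\<close> elements,
    enough for distinct labels.\<close>
  obtain f where f: "f ` ?C \<subseteq> Pow ?Z" "inj_on f ?C"
    using card_le_inj[OF finite_maximal_abelian_subgroups[OF fin], of "Pow ?Z"] finZ card
    by (auto simp: card_Pow)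
  have "\<forall>g \<in> carrier G. \<exists>H. maximal_abelian_subgroup H G \<and> g \<in> H"
    using ex_maximal_abelian_subgroup[OF fin] by metis
  then obtain M where M: "\<And>g. g \<in> carrier G \<Longrightarrow> maximal_abelian_subgroup (M g) G"
      "\<And>g. g \<in> carrier G \<Longrightarrow> g \<in> M g"
    by metis
  \<comment> \<open>Edges that do not join a noncentral to a central element get the default color
    0; the two-edge paths built below never use them.\<close>
  define c :: "'a set \<Rightarrow> nat" where
    "c e = (if \<exists>g \<in> carrier G - ?Z. \<exists>z \<in> ?Z. e = {g, z} \<and> z \<in> f (M g) then 1 else 0)" for e
  \<comment> \<open>The unordered edge determines which endpoint is noncentral, so the witnesses in
    \<open>c\<close> can only be \<open>g\<close> and \<open>z\<close>.\<close>
  have c_eq: "c {g, z} = (if z \<in> f (M g) then 1 else 0)"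
    if "g \<in> carrier G - ?Z" "z \<in> ?Z" for g z
    using that by (auto simp: c_def doubleton_eq_iff)
  have "\<exists>p. path_between (commuting_graph G) u p v \<and> distinct (map c (path_edges p))"
    if uv: "u \<in> carrier G" "v \<in> carrier G" "u \<noteq> v" for u v
  proof (cases "u \<otimes> v = v \<otimes> u")
    case True
    then have "path_between (commuting_graph G) u [u, v] v"
      using uv by (intro path_between_edge) (simp_all add: edge_commuting_graph_iff)
    then show ?thesis by (intro exI[of _ "[u, v]"]) simp
  next
    case False
    \<comment> \<open>Needed for \<open>c_eq\<close>, and to see that a central \<open>z\<close>
      differs from both \<open>u\<close> and \<open>v\<close>.\<close>
    have nZ: "u \<in> carrier G - ?Z" "v \<in> carrier G - ?Z"
      using False uv Z_comm[of u v] Z_comm[of v u] by auto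
    \<comment> \<open>Otherwise \<open>u\<close> and \<open>v\<close> would lie in a common abelian
      subgroup and commute.\<close>
    have "M u \<noteq> M v"
      using False M uv abelian_subgroup_commute[of "M u" u v]
      by (auto simp: maximal_abelian_subgroup_def)
    then have "f (M u) \<noteq> f (M v)"
      using f(2) M(1) uv by (auto dest: inj_onD)
    \<comment> \<open>Both labels are subsets of \<open>?Z\<close>, so an element separating them is
      central.\<close>
    then obtain z where z: "z \<in> ?Z" "z \<in> f (M u) \<longleftrightarrow> z \<notin> f (M v)"
      using f(1) M(1) uv by blast
    have "c {u, z} \<noteq> c {z, v}"
      using z nZ c_eq[of u z] c_eq[of v z] by (simp add: insert_commute)
    moreover have "path_between (commuting_graph G) u [u, z, v] v"
      using z(1) nZ uv ZG Z_comm
      by (auto simp: path_between_def edge_commuting_graph_iff)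
    ultimately show ?thesis
      by (intro exI[of _ "[u, z, v]"]) simp
  qed
  then have "rainbow_coloring (commuting_graph G) c"
    by (simp add: rainbow_coloring_def)
  moreover have "c ` edges (commuting_graph G) \<subseteq> {..<2}"
    by (auto simp: c_def)
  ultimately show ?thesis by (rule that[rotated])
qed

end

theorem theorem4:
  fixes G :: "('a, 'b) monoid_scheme"
  assumes "group G"
    and "finite (carrier G)"
    and "\<not> comm_group G"
    and "card (center G) \<ge> 2"
    and "card {H. maximal_abelian_subgroup H G} \<le> 2 ^ card (center G)"
  shows "rainbow_connection_number (commuting_graph G) = 2"
proof -
  interpret group G by fact
  obtain u v where uv: "u \<in> carrier G" "v \<in> carrier G" "u \<otimes>\<^bsub>G\<^esub> v \<noteq> v \<otimes>\<^bsub>G\<^esub> u"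
    using ex_noncommuting[OF assms(3)] .
  show ?thesis
    unfolding rainbow_connection_number_def
  proof (rule Least_equality)
    show "\<exists>c. c ` edges (commuting_graph G) \<subseteq> {..<2} \<and> rainbow_coloring (commuting_graph G) c"
      using ex_rainbow_2_coloring_commuting_graph[OF assms(2,5)] by metis
  next
    fix k
    assume "\<exists>c. c ` edges (commuting_graph G) \<subseteq> {..<k} \<and> rainbow_coloring (commuting_graph G) c"
    \<comment> \<open>Noncommuting \<open>u\<close> and \<open>v\<close> are distinct and
      nonadjacent.\<close>
    then show "2 \<le> k"
      using uv rainbow_coloring_nonadjacent_card[of "commuting_graph G" _ k u v]
      by (auto simp: edge_commuting_graph_iff)
  qed
qed

end
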